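(* Let $n,m\ge 1$ be integers and let $\mathbf{W}\in\mathbb{C}^{m\times m}$ be arbitrary, with largest and smallest singular values $\sigma_{\max}(\mathbf{W})$ and $\sigma_{\min}(\mathbf{W})$. Let $\mathbb{M}_{n,m}\in\mathbb{C}^{mn\times m(n+1)}$ be the block matrix with $n$ block rows and $n+1$ block columns of $m\times m$ blocks whose $(j,j)$ block is the identity $\mathbf{I}$ and whose $(j,j+1)$ block is $\mathbf{W}$ for $1\le j\le n$, all other blocks being zero, and let $\mathbb{A}_{n,m}=\mathbb{M}_{n,m}\mathbb{M}_{n,m}^*$, regarded as an $n\times n$ block matrix with $m\times m$ blocks. Suppose $\mathbb{A}_{n,m}$ is row block strictly diagonally dominant. If $\sigma_{\max}(\mathbf{W})<\frac12$, then $$\kappa(\mathbb{M}_{n,m})\le\left(\frac{1+2\sigma_{\max}(\mathbf{W})+\sigma_{\max}(\mathbf{W})^2}{1-2\sigma_{\max}(\mathbf{W})+\sigma_{\min}(\mathbf{W})^2}\right)^{1/2}.$$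
   Context: $*$ denotes the Hermitian transpose. A block matrix $\mathbb{A}=[\mathbf{A}_{jk}]_{j,k=1}^n$ with blocks $\mathbf{A}_{jk}\in\mathbb{C}^{m\times m}$ is row block strictly diagonally dominant if every diagonal block $\mathbf{A}_{jj}$ is nonsingular and $\sum_{k\ne j}\|\mathbf{A}_{jj}^{-1}\mathbf{A}_{jk}\|_{\mathrm{op}}<1$ for every $j\in\{1,\dots,n\}$, where $\|\cdot\|_{\mathrm{op}}$ is the operator norm (largest singular value). The singular values of $\mathbb{M}_{n,m}$ are the square roots of the $mn$ eigenvalues of $\mathbb{A}_{n,m}$, and $\kappa(\mathbb{M}_{n,m})=\sigma_{\max}(\mathbb{M}_{n,m})/\sigma_{\min}(\mathbb{M}_{n,m})$ is the condition number. *)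

theory Defs
  imports
    Complex_Main
    "Jordan_Normal_Form.Char_Poly"
    "Jordan_Normal_Form.Gauss_Jordan_Elimination"
    "Jordan_Normal_Form.Schur_Decomposition"
begin

(* The nonnegative square roots of the eigenvalues of A * A^*, as a set: multiplicities are
   dropped, which does not affect the largest and smallest elements.  This gives all singular
   values when dim_row A <= dim_col A; for a tall A one would have to take A^* * A instead. *)
definition singular_values :: "complex mat \<Rightarrow> real set" where
  "singular_values A =
     {s. 0 \<le> s \<and> eigenvalue (A * mat_adjoint A) (complex_of_real (s\<^sup>2))}"

definition sigma_max :: "complex mat \<Rightarrow> real" where
  "sigma_max A = Max (singular_values A)"

definition sigma_min :: "complex mat \<Rightarrow> real" where
  "sigma_min A = Min (singular_values A)"

definition op_norm :: "complex mat \<Rightarrow> real" where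
  "op_norm A = sigma_max A"

definition cond_number :: "complex mat \<Rightarrow> real" where
  "cond_number A = sigma_max A / sigma_min A"

(* Block indices, like matrix indices, start at 0. *)
definition of_blocks :: "nat \<Rightarrow> nat \<Rightarrow> nat \<Rightarrow> (nat \<Rightarrow> nat \<Rightarrow> complex mat) \<Rightarrow> complex mat" where
  "of_blocks p q m B =
     mat (p * m) (q * m) (\<lambda>(r, c). B (r div m) (c div m) $$ (r mod m, c mod m))"

definition block :: "nat \<Rightarrow> complex mat \<Rightarrow> nat \<Rightarrow> nat \<Rightarrow> complex mat" where
  "block m A j k = mat m m (\<lambda>(a, b). A $$ (j * m + a, k * m + b))"

(* mat_inverse returns Some of the inverse of an invertible square matrix. *)
definition row_block_strictly_diag_dominant :: "nat \<Rightarrow> nat \<Rightarrow> complex mat \<Rightarrow> bool" where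
  "row_block_strictly_diag_dominant n m A \<longleftrightarrow>
     A \<in> carrier_mat (n * m) (n * m) \<and>
     (\<forall>j<n. invertible_mat (block m A j j) \<and>
        (\<Sum>k\<in>{..<n} - {j}. op_norm (the (mat_inverse (block m A j j)) * block m A j k)) < 1)"

definition M_mat :: "nat \<Rightarrow> nat \<Rightarrow> complex mat \<Rightarrow> complex mat" where
  "M_mat n m W =
     of_blocks n (n + 1) m
       (\<lambda>j k. if k = j then 1\<^sub>m m else if k = j + 1 then W else 0\<^sub>m m m)"

definition A_mat :: "nat \<Rightarrow> nat \<Rightarrow> complex mat \<Rightarrow> complex mat" where
  "A_mat n m W = M_mat n m W * mat_adjoint (M_mat n m W)"

end

theory Submission
  imports Defs
begin

text \<open>The squared extreme singular values of \<open>M\<close> are the extreme values of the Rayleigh quotient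
  \<open>|M\<^sup>* x|\<^sup>2 / |x|\<^sup>2\<close>. The \<open>k\<close>-th block of \<open>M\<^sup>* x\<close> is \<open>x\<^sub>k + W\<^sup>* x\<^sub>k\<^sub>-\<^sub>1\<close>, with zero blocks beyond
  both ends of \<open>x\<close>. Expanding its squared norm, the cross term is at most
  \<open>\<sigma>\<^sub>m\<^sub>a\<^sub>x(W) (|x\<^sub>k|\<^sup>2 + |x\<^sub>k\<^sub>-\<^sub>1|\<^sup>2)\<close> in absolute value, so summing over \<open>k\<close> bounds the quotient by the
  numerator from above and by the denominator from below.\<close>

section \<open>Squared Euclidean norms and the Hermitian inner product\<close>

text \<open>Real-valued, unlike \<open>v \<bullet>c v\<close>, so that it can stand in
  inequalities.\<close>

definition sq_norm :: "complex vec \<Rightarrow> real" where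
  "sq_norm v = (\<Sum>i<dim_vec v. (cmod (v $ i))\<^sup>2)"

lemma sq_norm_nonneg [simp]: "0 \<le> sq_norm v"
  unfolding sq_norm_def by (simp add: sum_nonneg)

lemma sq_norm_zero_vec [simp]: "sq_norm (0\<^sub>v n) = 0"
  unfolding sq_norm_def by simp

lemma sq_norm_pos:
  assumes "v \<in> carrier_vec n" and "v \<noteq> 0\<^sub>v n"
  shows "0 < sq_norm v"
proof -
  obtain i where i: "i < n" "v $ i \<noteq> 0"
    using assms by (metis carrier_vecD eq_vecI index_zero_vec)
  have "0 < (cmod (v $ i))\<^sup>2" using i by simp
  also have "\<dots> \<le> sq_norm v"
    unfolding sq_norm_def using i assms(1) by (intro member_le_sum) auto
  finally show ?thesis .
qed

lemma cscalar_prod_sum: "v \<bullet>c w = (\<Sum>i<dim_vec w. v $ i * cnj (w $ i))"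
  unfolding scalar_prod_def by (simp add: lessThan_atLeast0)

lemma cscalar_prod_self: "v \<bullet>c v = complex_of_real (sq_norm v)"
  unfolding cscalar_prod_sum sq_norm_def by (simp add: complex_norm_square [symmetric])

lemma sq_norm_add:
  assumes "v \<in> carrier_vec n" and "w \<in> carrier_vec n"
  shows "sq_norm (v + w) = sq_norm v + sq_norm w + 2 * Re (v \<bullet>c w)"
proof -
  have "(cmod (a + b))\<^sup>2 = (cmod a)\<^sup>2 + (cmod b)\<^sup>2 + 2 * Re (a * cnj b)" for a b :: complex
    unfolding cmod_power2 by (simp add: power2_eq_square algebra_simps)
  then show ?thesis
    using assms unfolding cscalar_prod_sum sq_norm_def
    by (simp add: sum.distrib sum_distrib_left)
qed

lemma sq_norm_smult: "sq_norm (c \<cdot>\<^sub>v v) = (cmod c)\<^sup>2 * sq_norm v"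
  unfolding sq_norm_def by (simp add: norm_mult power_mult_distrib sum_distrib_left)

text \<open>A weighted AM-GM inequality, from expanding the nonnegative number s |v - e w / s|^2 for
  both signs e. The free weight \<open>s\<close> is later set to \<open>sigma_max W\<close>.\<close>

lemma abs_Re_cscalar_prod_le:
  assumes "v \<in> carrier_vec n" and "w \<in> carrier_vec n" and "0 < s"
  shows "2 * \<bar>Re (v \<bullet>c w)\<bar> \<le> s * sq_norm v + sq_norm w / s"
proof -
  have key: "2 * e * Re (v \<bullet>c w) \<le> s * sq_norm v + sq_norm w / s"
    if "e = 1 \<or> e = -1" for e :: real
  proof -
    \<comment> \<open>With this multiple of \<open>w\<close>, scaling the expanded square by
      \<open>s\<close> leaves the cross term with coefficient exactly \<open>2 * e\<close>.\<close>
    let ?c = "complex_of_real (- e / s)"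
    have "0 \<le> s * sq_norm (v + ?c \<cdot>\<^sub>v w)"
      using assms(3) by simp
    also have "sq_norm (v + ?c \<cdot>\<^sub>v w) = sq_norm v + sq_norm w / s\<^sup>2 - 2 * e * Re (v \<bullet>c w) / s"
    proof -
      have "v \<bullet>c (?c \<cdot>\<^sub>v w) = ?c * (v \<bullet>c w)"
        using assms unfolding cscalar_prod_sum by (simp add: sum_distrib_left algebra_simps)
      then have "Re (v \<bullet>c (?c \<cdot>\<^sub>v w)) = - e / s * Re (v \<bullet>c w)"
        by (simp add: times_complex.sel)
      moreover have "(cmod ?c)\<^sup>2 = 1 / s\<^sup>2"
        unfolding norm_of_real using that by (auto simp: power_divide)
      ultimately show ?thesis
        using assms by (simp add: sq_norm_add[of _ n] sq_norm_smult)
    qed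
    also have "s * \<dots> = s * sq_norm v + sq_norm w / s - 2 * e * Re (v \<bullet>c w)"
      using assms(3) by (simp add: field_simps power2_eq_square)
    finally show ?thesis by simp
  qed
  show ?thesis using key[of 1] key[of "-1"] by (auto simp: abs_if)
qed

section \<open>Hermitian transposes\<close>

lemma mat_adjoint_dim [simp]:
  "dim_row (mat_adjoint A) = dim_col A" "dim_col (mat_adjoint A) = dim_row A"
  unfolding mat_adjoint_def by auto

lemma mat_adjoint_carrier:
  "A \<in> carrier_mat n k \<Longrightarrow> mat_adjoint A \<in> carrier_mat k n"
  unfolding mat_adjoint_def by auto

lemma mat_adjoint_index:
  assumes "A \<in> carrier_mat n k" and "i < k" and "j < n"
  shows "mat_adjoint A $$ (i, j) = cnj (A $$ (j, i))"
  using assms unfolding mat_adjoint_def by (simp add: mat_of_rows_index)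

lemma mult_mat_vec_index_sum:
  assumes "A \<in> carrier_mat n k" and "v \<in> carrier_vec k" and "i < n"
  shows "(A *\<^sub>v v) $ i = (\<Sum>j<k. A $$ (i, j) * v $ j)"
  using assms by (simp add: scalar_prod_def lessThan_atLeast0)

lemma cscalar_prod_adjoint:
  fixes A :: "complex mat"
  assumes A: "A \<in> carrier_mat n k" and v: "v \<in> carrier_vec k" and w: "w \<in> carrier_vec n"
  shows "(A *\<^sub>v v) \<bullet>c w = v \<bullet>c (mat_adjoint A *\<^sub>v w)"
proof -
  have "(A *\<^sub>v v) \<bullet>c w = (\<Sum>i<n. \<Sum>j<k. A $$ (i, j) * v $ j * cnj (w $ i))"
    unfolding cscalar_prod_sum using assms
    by (simp add: mult_mat_vec_index_sum[OF A v] sum_distrib_right del: index_mult_mat_vec)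
  also have "\<dots> = (\<Sum>j<k. \<Sum>i<n. A $$ (i, j) * v $ j * cnj (w $ i))"
    by (rule sum.swap)
  also have "\<dots> = v \<bullet>c (mat_adjoint A *\<^sub>v w)"
  proof -
    have dim: "dim_vec (mat_adjoint A *\<^sub>v w) = k"
      using A by simp
    show ?thesis
      unfolding cscalar_prod_sum dim
      by (rule sum.cong[OF refl],
          subst mult_mat_vec_index_sum[OF mat_adjoint_carrier[OF A] w])
         (auto simp: mat_adjoint_index[OF A] sum_distrib_left algebra_simps intro!: sum.cong)
  qed
  finally show ?thesis .
qed

section \<open>Quadratic forms and extreme eigenvalues of Hermitian matrices\<close>

text \<open>A crude bound by the sum of the moduli of all entries suffices, since only finiteness
  matters. Adding 1 makes the constant positive even for the zero matrix, so that one may divide by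
  it.\<close>

lemma quadratic_form_bounded:
  assumes A: "A \<in> carrier_mat n n"
  obtains C where "0 < C"
    and "\<And>x. x \<in> carrier_vec n \<Longrightarrow> \<bar>Re ((A *\<^sub>v x) \<bullet>c x)\<bar> \<le> C * sq_norm x"
proof
  let ?C = "(\<Sum>i<n. \<Sum>j<n. cmod (A $$ (i, j)))"
  show "0 < ?C + 1"
    by (smt (verit) sum_nonneg norm_ge_zero)
  fix x :: "complex vec" assume x: "x \<in> carrier_vec n"
  have "(A *\<^sub>v x) \<bullet>c x = (\<Sum>i<n. \<Sum>j<n. A $$ (i, j) * x $ j * cnj (x $ i))"
    unfolding cscalar_prod_sum using x A
    by (simp add: mult_mat_vec_index_sum[OF A x] sum_distrib_right del: index_mult_mat_vec)
  then have "cmod ((A *\<^sub>v x) \<bullet>c x) \<le> (\<Sum>i<n. \<Sum>j<n. cmod (A $$ (i, j) * x $ j * cnj (x $ i)))"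
    by (simp add: order_trans[OF norm_sum] sum_mono)
  also have "\<dots> \<le> (\<Sum>i<n. \<Sum>j<n. cmod (A $$ (i, j)) * sq_norm x)"
  proof (intro sum_mono)
    fix i j assume ij: "i \<in> {..<n}" "j \<in> {..<n}"
    have le: "(cmod (x $ l))\<^sup>2 \<le> sq_norm x" if "l < n" for l
      unfolding sq_norm_def using that x by (intro member_le_sum) auto
    \<comment> \<open>AM-GM: twice the product is at most the sum of the two squares, each of which
      is at most \<open>sq_norm x\<close>.\<close>
    have "cmod (x $ j) * cmod (x $ i) \<le> sq_norm x"
      using le[of i] le[of j] ij sum_squares_bound[of "cmod (x $ j)" "cmod (x $ i)"] by simp
    then show "cmod (A $$ (i, j) * x $ j * cnj (x $ i)) \<le> cmod (A $$ (i, j)) * sq_norm x"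
      by (simp add: norm_mult mult.assoc mult_left_mono)
  qed
  also have "\<dots> = ?C * sq_norm x"
    by (simp add: sum_distrib_right)
  also have "\<dots> \<le> (?C + 1) * sq_norm x"
    by (simp add: mult_right_mono)
  finally show "\<bar>Re ((A *\<^sub>v x) \<bullet>c x)\<bar> \<le> (?C + 1) * sq_norm x"
    using abs_Re_le_cmod order_trans by blast
qed

lemma char_matrix_mult_vec:
  assumes A: "A \<in> carrier_mat n n" and x: "x \<in> carrier_vec n"
  shows "char_matrix A e *\<^sub>v x = A *\<^sub>v x + (- e) \<cdot>\<^sub>v x"
  using assms unfolding char_matrix_def
  by (subst add_mult_distrib_mat_vec[of _ n n]) (auto intro!: eq_vecI)

text \<open>The shift \<open>t\<close> is real, so conjugation fixes the diagonal that is
  subtracted.\<close>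

lemma mat_adjoint_char_matrix:
  assumes A: "A \<in> carrier_mat n n" and herm: "mat_adjoint A = A"
  shows "mat_adjoint (char_matrix A (complex_of_real t)) = char_matrix A (complex_of_real t)"
    (is "mat_adjoint ?L = ?L")
proof (rule eq_matI)
  have L: "?L \<in> carrier_mat n n" using A unfolding char_matrix_def by simp
  note L' = mat_adjoint_carrier[OF L]
  show "dim_row (mat_adjoint ?L) = dim_row ?L" "dim_col (mat_adjoint ?L) = dim_col ?L"
    using L L' by auto
  fix i j assume "i < dim_row ?L" "j < dim_col ?L"
  then have ij: "i < n" "j < n" using L by auto
  have "cnj (A $$ (j, i)) = A $$ (i, j)"
    using mat_adjoint_index[OF A ij] herm by simp
  then show "mat_adjoint ?L $$ (i, j) = ?L $$ (i, j)"
    unfolding mat_adjoint_index[OF L ij] using A ij unfolding char_matrix_def by auto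
qed

text \<open>Let \<open>t\<close> be the largest number such that \<open>L = K - t I\<close> is positive semidefinite. If \<open>L\<close> had an
  inverse \<open>B\<close>, then evaluating the form of \<open>L\<close> at \<open>x - B x / D\<close>, where \<open>D\<close> bounds the form of \<open>B\<close>,
  would show that its form is at least \<open>|x|\<^sup>2 / D\<close>, against the choice of \<open>t\<close>. So \<open>t\<close> is an
  eigenvalue, and no spectral theorem is needed.\<close>
lemma hermitian_min_eigenvalue:
  assumes K: "K \<in> carrier_mat n n" and herm: "mat_adjoint K = K" and n: "0 < n"
  obtains t where "eigenvalue K (complex_of_real t)"
    and "\<And>x. x \<in> carrier_vec n \<Longrightarrow> t * sq_norm x \<le> Re ((K *\<^sub>v x) \<bullet>c x)"
proof -
  define S where "S = {t. \<forall>x\<in>carrier_vec n. t * sq_norm x \<le> Re ((K *\<^sub>v x) \<bullet>c x)}"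
  obtain C where C: "\<And>x. x \<in> carrier_vec n \<Longrightarrow> \<bar>Re ((K *\<^sub>v x) \<bullet>c x)\<bar> \<le> C * sq_norm x"
    using quadratic_form_bounded[OF K] by blast
  \<comment> \<open>Nonemptiness of \<open>S\<close>, needed for its supremum.\<close>
  have "- C \<in> S" unfolding S_def using C by (force simp: abs_le_iff)
  have le_S: "t \<le> Re ((K *\<^sub>v x) \<bullet>c x) / sq_norm x"
    if "t \<in> S" "x \<in> carrier_vec n" "x \<noteq> 0\<^sub>v n" for t x
    using that sq_norm_pos[of x n] unfolding S_def by (simp add: pos_le_divide_eq)
  \<comment> \<open>Any nonzero vector bounds \<open>S\<close> through its Rayleigh quotient;
    \<open>0 < n\<close> supplies a unit vector.\<close>
  have bdd: "bdd_above S"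
    using le_S[of _ "unit_vec n 0"] n by (intro bdd_aboveI) auto
  define t where "t = Sup S"
  \<comment> \<open>The supremum itself lies in \<open>S\<close>: every Rayleigh quotient is an
    upper bound of \<open>S\<close>. The zero vector has no quotient and is treated apart.\<close>
  have tS: "t * sq_norm x \<le> Re ((K *\<^sub>v x) \<bullet>c x)" if x: "x \<in> carrier_vec n" for x
  proof (cases "x = 0\<^sub>v n")
    case True
    then show ?thesis using C[OF x] by simp
  next
    case False
    have "t \<le> Re ((K *\<^sub>v x) \<bullet>c x) / sq_norm x"
      unfolding t_def using \<open>- C \<in> S\<close> le_S[OF _ x False] by (intro cSup_least) auto
    then show ?thesis using sq_norm_pos[OF x False] by (simp add: pos_le_divide_eq)
  qed
  define L where "L = char_matrix K (complex_of_real t)"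
  have L: "L \<in> carrier_mat n n" using K unfolding L_def char_matrix_def by simp
  have L_adj: "mat_adjoint L = L"
    unfolding L_def by (rule mat_adjoint_char_matrix[OF K herm])
  have L_form: "Re ((L *\<^sub>v x) \<bullet>c x) = Re ((K *\<^sub>v x) \<bullet>c x) - t * sq_norm x"
    if x: "x \<in> carrier_vec n" for x
  proof -
    have "(L *\<^sub>v x) \<bullet>c x = (K *\<^sub>v x) \<bullet>c x + (- complex_of_real t) * (x \<bullet>c x)"
      unfolding L_def char_matrix_mult_vec[OF K x]
      using K x by (subst add_scalar_prod_distrib[of _ n]) auto
    then show ?thesis by (simp add: cscalar_prod_self)
  qed
  have "det L = 0"
  proof (rule ccontr)
    assume "det L \<noteq> 0"
    \<comment> \<open>\<open>undefined\<close> fills the extension slot of the matrix ring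
      record.\<close>
    from det_non_zero_imp_unit[OF L this, of undefined]
    obtain B where B: "B \<in> carrier_mat n n" and LB: "L * B = 1\<^sub>m n"
      unfolding Units_def ring_mat_def by auto
    obtain D where D: "0 < D"
      and BD: "\<And>x. x \<in> carrier_vec n \<Longrightarrow> \<bar>Re ((B *\<^sub>v x) \<bullet>c x)\<bar> \<le> D * sq_norm x"
      using quadratic_form_bounded[OF B] by blast
    have "t + 1 / D \<in> S"
      unfolding S_def
    proof (intro CollectI ballI)
      fix x :: "complex vec" assume x: "x \<in> carrier_vec n"
      define y where "y = B *\<^sub>v x"
      define c where "c = complex_of_real (- 1 / D)"
      have c_real: "cnj c = c" unfolding c_def by simp
      have y: "y \<in> carrier_vec n" using B x unfolding y_def by simp
      have Ly: "L *\<^sub>v y = x"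
        unfolding y_def using L B x LB by (simp flip: assoc_mult_mat_vec)
      have Lx: "L *\<^sub>v x \<in> carrier_vec n" using L x by simp
      \<comment> \<open>\<open>L\<close> is self-adjoint and maps \<open>y\<close> to
        \<open>x\<close>, so it can be moved across the product.\<close>
      have Lxy: "(L *\<^sub>v x) \<bullet>c y = x \<bullet>c x"
        using cscalar_prod_adjoint[OF L x y] L_adj Ly by simp
      have xy: "Re (x \<bullet>c y) = Re (y \<bullet>c x)"
        using x y unfolding cscalar_prod_sum by (simp add: mult.commute)
      have "0 \<le> Re ((L *\<^sub>v (x + c \<cdot>\<^sub>v y)) \<bullet>c (x + c \<cdot>\<^sub>v y))"
        using tS[of "x + c \<cdot>\<^sub>v y"] L_form[of "x + c \<cdot>\<^sub>v y"] x y by simp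
      also have "L *\<^sub>v (x + c \<cdot>\<^sub>v y) = L *\<^sub>v x + c \<cdot>\<^sub>v x"
        using L x y Ly by (simp add: mult_add_distrib_mat_vec mult_mat_vec)
      also have "(L *\<^sub>v x + c \<cdot>\<^sub>v x) \<bullet>c (x + c \<cdot>\<^sub>v y) =
          (L *\<^sub>v x) \<bullet>c x + c * ((L *\<^sub>v x) \<bullet>c y) + c * (x \<bullet>c x) + c * c * (x \<bullet>c y)"
        using x y Lx c_real unfolding cscalar_prod_sum
        by (simp add: sum.distrib sum_distrib_left algebra_simps)
      \<comment> \<open>The two mixed terms give -2/D times |x|^2, while the last term costs at most
        |x|^2 / D by the bound on the form of \<open>B\<close>. The net gain is |x|^2 / D.\<close>
      also have "Re \<dots> = Re ((L *\<^sub>v x) \<bullet>c x) - 2 / D * sq_norm x + Re (y \<bullet>c x) / D\<^sup>2"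
        unfolding Lxy cscalar_prod_self c_def xy[symmetric]
        by (simp add: power2_eq_square)
      finally have "2 / D * sq_norm x \<le> Re ((L *\<^sub>v x) \<bullet>c x) + Re (y \<bullet>c x) / D\<^sup>2" by simp
      also have "Re (y \<bullet>c x) / D\<^sup>2 \<le> sq_norm x / D"
        using BD[OF x] D unfolding y_def by (simp add: field_simps power2_eq_square abs_le_iff)
      finally have "sq_norm x / D \<le> Re ((L *\<^sub>v x) \<bullet>c x)" by simp
      then show "(t + 1 / D) * sq_norm x \<le> Re ((K *\<^sub>v x) \<bullet>c x)"
        unfolding L_form[OF x] by (simp add: algebra_simps)
    qed
    then have "t + 1 / D \<le> t" unfolding t_def using bdd by (intro cSup_upper)
    then show False using D by simp
  qed
  then have "eigenvalue K (complex_of_real t)"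
    unfolding L_def eigenvalue_det[OF K] .
  then show ?thesis using that tS by blast
qed

text \<open>The minimal eigenvalue of \<open>- K\<close>, with its sign reversed.\<close>

lemma hermitian_max_eigenvalue:
  assumes K: "K \<in> carrier_mat n n" and herm: "mat_adjoint K = K" and n: "0 < n"
  obtains t where "eigenvalue K (complex_of_real t)"
    and "\<And>x. x \<in> carrier_vec n \<Longrightarrow> Re ((K *\<^sub>v x) \<bullet>c x) \<le> t * sq_norm x"
proof -
  have uK: "- K \<in> carrier_mat n n" using K by simp
  have uherm: "mat_adjoint (- K) = - K"
  proof (rule eq_matI)
    show "dim_row (mat_adjoint (- K)) = dim_row (- K)" "dim_col (mat_adjoint (- K)) = dim_col (- K)"
      using mat_adjoint_carrier[OF uK] K by auto
    fix i j assume "i < dim_row (- K)" "j < dim_col (- K)"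
    then have ij: "i < n" "j < n" using K by auto
    have "cnj (K $$ (j, i)) = K $$ (i, j)"
      using mat_adjoint_index[OF K ij] herm by simp
    then show "mat_adjoint (- K) $$ (i, j) = (- K) $$ (i, j)"
      unfolding mat_adjoint_index[OF uK ij] using K ij by simp
  qed
  obtain t where ev: "eigenvalue (- K) (complex_of_real t)"
    and t: "\<And>x. x \<in> carrier_vec n \<Longrightarrow> t * sq_norm x \<le> Re (((- K) *\<^sub>v x) \<bullet>c x)"
    using hermitian_min_eigenvalue[OF uK uherm n] by blast
  from ev obtain v where v: "v \<in> carrier_vec n" "v \<noteq> 0\<^sub>v n" "(- K) *\<^sub>v v = complex_of_real t \<cdot>\<^sub>v v"
    unfolding eigenvalue_def eigenvector_def using K by auto
  have neg: "(- K) *\<^sub>v x = - (K *\<^sub>v x)" if "x \<in> carrier_vec n" for x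
    using K that by (intro eq_vecI) auto
  have "K *\<^sub>v v = - (- (K *\<^sub>v v))" by simp
  also have "\<dots> = complex_of_real (- t) \<cdot>\<^sub>v v"
    unfolding neg[OF v(1), symmetric] v(3) by (intro eq_vecI) auto
  finally have "eigenvalue K (complex_of_real (- t))"
    unfolding eigenvalue_def eigenvector_def using v K by auto
  moreover have "Re ((K *\<^sub>v x) \<bullet>c x) \<le> - t * sq_norm x" if x: "x \<in> carrier_vec n" for x
    using t[OF x] K x unfolding neg[OF x] cscalar_prod_sum by (simp add: sum_negf)
  ultimately show ?thesis using that by blast
qed

section \<open>Gram matrices and singular values\<close>

lemma mat_adjoint_gram:
  fixes A :: "complex mat"
  assumes A: "A \<in> carrier_mat n k"
  shows "mat_adjoint (A * mat_adjoint A) = A * mat_adjoint A"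
proof (rule eq_matI)
  note A' = mat_adjoint_carrier[OF A]
  have G: "A * mat_adjoint A \<in> carrier_mat n n" using A A' by simp
  note G' = mat_adjoint_carrier[OF G]
  show "dim_row (mat_adjoint (A * mat_adjoint A)) = dim_row (A * mat_adjoint A)"
    "dim_col (mat_adjoint (A * mat_adjoint A)) = dim_col (A * mat_adjoint A)"
    using G G' by auto
  fix i j assume "i < dim_row (A * mat_adjoint A)" "j < dim_col (A * mat_adjoint A)"
  then have ij: "i < n" "j < n" using G by auto
  have entry: "(A * mat_adjoint A) $$ (p, q) = (\<Sum>l<k. A $$ (p, l) * cnj (A $$ (q, l)))"
    if "p < n" "q < n" for p q
    using A A' that by (simp add: mat_adjoint_index[OF A] scalar_prod_def lessThan_atLeast0)
  show "mat_adjoint (A * mat_adjoint A) $$ (i, j) = (A * mat_adjoint A) $$ (i, j)"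
    unfolding mat_adjoint_index[OF G ij] entry[OF ij] entry[OF ij(2,1)]
    by (simp add: mult.commute)
qed

text \<open>Identifies the Rayleigh quotient of the Gram matrix with |A^* x|^2 / |x|^2 by moving
  \<open>A\<close> across the inner product.\<close>

lemma gram_form:
  assumes A: "A \<in> carrier_mat n k" and x: "x \<in> carrier_vec n"
  shows "Re (((A * mat_adjoint A) *\<^sub>v x) \<bullet>c x) = sq_norm (mat_adjoint A *\<^sub>v x)"
proof -
  note A' = mat_adjoint_carrier[OF A]
  have y: "mat_adjoint A *\<^sub>v x \<in> carrier_vec k" using A' x by simp
  have "(A * mat_adjoint A) *\<^sub>v x = A *\<^sub>v (mat_adjoint A *\<^sub>v x)"
    using A A' x by simp
  then show ?thesis
    using cscalar_prod_adjoint[OF A y x] by (simp add: cscalar_prod_self)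
qed

lemma gram_eigenvalue:
  assumes A: "A \<in> carrier_mat n k"
    and ev: "eigenvalue (A * mat_adjoint A) (complex_of_real t)"
  obtains x where "x \<in> carrier_vec n" and "x \<noteq> 0\<^sub>v n"
    and "sq_norm (mat_adjoint A *\<^sub>v x) = t * sq_norm x"
proof -
  from ev obtain x where x: "x \<in> carrier_vec n" "x \<noteq> 0\<^sub>v n"
    "(A * mat_adjoint A) *\<^sub>v x = complex_of_real t \<cdot>\<^sub>v x"
    unfolding eigenvalue_def eigenvector_def using A by auto
  have eq: "(complex_of_real t \<cdot>\<^sub>v x) \<bullet>c x = complex_of_real (t * sq_norm x)"
    using x by (simp add: cscalar_prod_self)
  have "sq_norm (mat_adjoint A *\<^sub>v x) = t * sq_norm x"
    using gram_form[OF A x(1)] unfolding x(3) eq by simp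
  then show ?thesis using that x by blast
qed

lemma gram_eigenvalue_nonneg:
  assumes A: "A \<in> carrier_mat n k"
    and ev: "eigenvalue (A * mat_adjoint A) (complex_of_real t)"
  shows "0 \<le> t"
proof -
  obtain x where x: "x \<in> carrier_vec n" "x \<noteq> 0\<^sub>v n"
    "sq_norm (mat_adjoint A *\<^sub>v x) = t * sq_norm x"
    using gram_eigenvalue[OF A ev] by blast
  have "0 \<le> t * sq_norm x" unfolding x(3)[symmetric] by simp
  then show ?thesis using sq_norm_pos[OF x(1,2)] by (simp add: zero_le_mult_iff)
qed

lemma singular_values_sqrt:
  assumes "A \<in> carrier_mat n k"
    and "eigenvalue (A * mat_adjoint A) (complex_of_real t)"
  shows "sqrt t \<in> singular_values A"
  using assms gram_eigenvalue_nonneg[OF assms] unfolding singular_values_def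
  by (simp flip: of_real_power)

text \<open>Needed for \<open>Max\<close> and \<open>Min\<close> to be attained. The squares are
  roots of the characteristic polynomial, which is monic and hence nonzero, and a nonnegative
  \<open>s\<close> is recovered from its square.\<close>

lemma finite_singular_values:
  assumes A: "A \<in> carrier_mat n k"
  shows "finite (singular_values A)"
proof -
  have G: "A * mat_adjoint A \<in> carrier_mat n n"
    using A mat_adjoint_carrier[OF A] by simp
  have "char_poly (A * mat_adjoint A) \<noteq> 0"
    using degree_monic_char_poly[OF G] by auto
  then have "finite {z. poly (char_poly (A * mat_adjoint A)) z = 0}"
    by (rule poly_roots_finite)
  then have "finite ((\<lambda>z. sqrt (Re z)) ` {z. eigenvalue (A * mat_adjoint A) z})"
    by (simp add: eigenvalue_root_char_poly[OF G])
  moreover have "singular_values A \<subseteq> (\<lambda>z. sqrt (Re z)) ` {z. eigenvalue (A * mat_adjoint A) z}"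
  proof
    fix s assume "s \<in> singular_values A"
    then have "0 \<le> s" "eigenvalue (A * mat_adjoint A) (complex_of_real (s\<^sup>2))"
      unfolding singular_values_def by auto
    then show "s \<in> (\<lambda>z. sqrt (Re z)) ` {z. eigenvalue (A * mat_adjoint A) z}"
      by (intro image_eqI[of _ _ "complex_of_real (s\<^sup>2)"]) (auto simp flip: of_real_power)
  qed
  ultimately show ?thesis by (rule finite_subset[rotated])
qed

text \<open>An eigenvector of the Gram matrix serves as \<open>x\<close>. This turns bounds on |A^*
  x|^2 valid for all \<open>x\<close> into bounds on singular values.\<close>

lemma singular_value_attained:
  assumes A: "A \<in> carrier_mat n k" and s: "s \<in> singular_values A"
  obtains x where "x \<in> carrier_vec n" and "x \<noteq> 0\<^sub>v n"
    and "sq_norm (mat_adjoint A *\<^sub>v x) = s\<^sup>2 * sq_norm x"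
  using s gram_eigenvalue[OF A, of "s\<^sup>2"] unfolding singular_values_def by blast

text \<open>The root of the largest eigenvalue of the Gram matrix is a singular value. So the set is
  nonempty, its maximum is attained, and the square of that maximum dominates the Rayleigh
  quotient.\<close>

lemma sigma_max_bound:
  assumes A: "A \<in> carrier_mat n k" and n: "0 < n"
  shows "sigma_max A \<in> singular_values A"
    and "x \<in> carrier_vec n \<Longrightarrow> sq_norm (mat_adjoint A *\<^sub>v x) \<le> (sigma_max A)\<^sup>2 * sq_norm x"
proof -
  have G: "A * mat_adjoint A \<in> carrier_mat n n"
    using A mat_adjoint_carrier[OF A] by simp
  obtain t where ev: "eigenvalue (A * mat_adjoint A) (complex_of_real t)"
    and t: "\<And>x. x \<in> carrier_vec n \<Longrightarrow> Re (((A * mat_adjoint A) *\<^sub>v x) \<bullet>c x) \<le> t * sq_norm x"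
    using hermitian_max_eigenvalue[OF G mat_adjoint_gram[OF A] n] by blast
  note mem = singular_values_sqrt[OF A ev]
  show "sigma_max A \<in> singular_values A"
    unfolding sigma_max_def using mem finite_singular_values[OF A] by (intro Max_in) auto
  assume x: "x \<in> carrier_vec n"
  have "sqrt t \<le> sigma_max A"
    unfolding sigma_max_def using mem finite_singular_values[OF A] by simp
  then have "t \<le> (sigma_max A)\<^sup>2" by (rule sqrt_le_D)
  then have "t * sq_norm x \<le> (sigma_max A)\<^sup>2 * sq_norm x"
    by (simp add: mult_right_mono)
  then show "sq_norm (mat_adjoint A *\<^sub>v x) \<le> (sigma_max A)\<^sup>2 * sq_norm x"
    using t[OF x] gram_form[OF A x] by simp
qed

text \<open>The same argument with the smallest eigenvalue; squaring the comparison also uses that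
  \<open>sigma_min A\<close> is nonnegative.\<close>

lemma sigma_min_bound:
  assumes A: "A \<in> carrier_mat n k" and n: "0 < n"
  shows "sigma_min A \<in> singular_values A"
    and "x \<in> carrier_vec n \<Longrightarrow> (sigma_min A)\<^sup>2 * sq_norm x \<le> sq_norm (mat_adjoint A *\<^sub>v x)"
proof -
  have G: "A * mat_adjoint A \<in> carrier_mat n n"
    using A mat_adjoint_carrier[OF A] by simp
  obtain t where ev: "eigenvalue (A * mat_adjoint A) (complex_of_real t)"
    and t: "\<And>x. x \<in> carrier_vec n \<Longrightarrow> t * sq_norm x \<le> Re (((A * mat_adjoint A) *\<^sub>v x) \<bullet>c x)"
    using hermitian_min_eigenvalue[OF G mat_adjoint_gram[OF A] n] by blast
  note mem = singular_values_sqrt[OF A ev]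
  show min_mem: "sigma_min A \<in> singular_values A"
    unfolding sigma_min_def using mem finite_singular_values[OF A] by (intro Min_in) auto
  assume x: "x \<in> carrier_vec n"
  have "sigma_min A \<le> sqrt t"
    unfolding sigma_min_def using mem finite_singular_values[OF A] by simp
  moreover have "0 \<le> sigma_min A"
    using min_mem unfolding singular_values_def by simp
  ultimately have "(sigma_min A)\<^sup>2 \<le> t"
    using gram_eigenvalue_nonneg[OF A ev] by (metis power_mono real_sqrt_pow2)
  then have "(sigma_min A)\<^sup>2 * sq_norm x \<le> t * sq_norm x"
    by (simp add: mult_right_mono)
  then show "(sigma_min A)\<^sup>2 * sq_norm x \<le> sq_norm (mat_adjoint A *\<^sub>v x)"
    using t[OF x] gram_form[OF A x] by simp
qed

lemma sigma_max_nonneg: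
  assumes "A \<in> carrier_mat n k" and "0 < n"
  shows "0 \<le> sigma_max A"
  using sigma_max_bound(1)[OF assms] unfolding singular_values_def by simp

text \<open>The weight \<open>sigma_max W\<close> balances the AM-GM bound, because |W^* z|^2
  divided by it is at most \<open>sigma_max W * sq_norm z\<close>. A zero weight cannot be divided
  by, but then W^* z vanishes.\<close>

lemma abs_Re_cscalar_prod_sigma_max_le:
  assumes W: "W \<in> carrier_mat m m" and m: "0 < m"
    and y: "y \<in> carrier_vec m" and z: "z \<in> carrier_vec m"
  shows "2 * \<bar>Re (y \<bullet>c (mat_adjoint W *\<^sub>v z))\<bar> \<le> sigma_max W * (sq_norm y + sq_norm z)"
proof -
  let ?s = "sigma_max W" and ?w = "mat_adjoint W *\<^sub>v z"
  have w: "?w \<in> carrier_vec m" using mat_adjoint_carrier[OF W] z by simp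
  have le: "sq_norm ?w \<le> ?s\<^sup>2 * sq_norm z" by (rule sigma_max_bound(2)[OF W m z])
  show ?thesis
  proof (cases "?s = 0")
    case True
    then have "?w = 0\<^sub>v m" using le sq_norm_pos[OF w] by fastforce
    then show ?thesis using True y by simp
  next
    case False
    then have s: "0 < ?s" using sigma_max_nonneg[OF W m] by simp
    have "2 * \<bar>Re (y \<bullet>c ?w)\<bar> \<le> ?s * sq_norm y + sq_norm ?w / ?s"
      by (rule abs_Re_cscalar_prod_le[OF y w s])
    also have "sq_norm ?w / ?s \<le> ?s * sq_norm z"
      using le s by (simp add: divide_le_eq power2_eq_square algebra_simps)
    finally show ?thesis by (simp add: algebra_simps)
  qed
qed

section \<open>Block vectors and the action of M^*\<close>

lemma sum_blocks: "(\<Sum>i<n * m. f i) = (\<Sum>j<n. \<Sum>a<m. f (j * m + a))"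
  for f :: "nat \<Rightarrow> 'a::comm_monoid_add"
proof -
  have "(\<Sum>i\<in>{j * m..<j * m + m}. f i) = (\<Sum>a<m. f (j * m + a))" for j
    using sum.shift_bounds_nat_ivl[of f 0 "j * m" m]
    by (simp add: lessThan_atLeast0 add.commute)
  then show ?thesis using sum.nat_group[of f m n] by simp
qed

lemma block_index_less:
  fixes j n a m :: nat
  assumes "j < n" and "a < m"
  shows "j * m + a < n * m"
proof -
  have "j * m + a < Suc j * m" using assms(2) by simp
  also have "\<dots> \<le> n * m" using assms(1) by (intro mult_le_mono1) simp
  finally show ?thesis .
qed

definition vec_block :: "nat \<Rightarrow> complex vec \<Rightarrow> nat \<Rightarrow> complex vec" where
  "vec_block m x j = vec m (\<lambda>a. x $ (j * m + a))"

lemma vec_block_carrier [simp]: "vec_block m x j \<in> carrier_vec m"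
  unfolding vec_block_def by simp

lemma sq_norm_vec_blocks:
  assumes "x \<in> carrier_vec (n * m)"
  shows "sq_norm x = (\<Sum>j<n. sq_norm (vec_block m x j))"
  using assms unfolding sq_norm_def vec_block_def by (simp add: sum_blocks)

lemma M_mat_carrier: "M_mat n m W \<in> carrier_mat (n * m) ((n + 1) * m)"
  unfolding M_mat_def of_blocks_def by simp

lemma M_mat_index:
  assumes "j < n" "k < n + 1" "a < m" "b < m"
  shows "M_mat n m W $$ (j * m + a, k * m + b) =
    (if k = j then 1\<^sub>m m $$ (a, b) else if k = j + 1 then W $$ (a, b) else 0)"
proof -
  have "j * m + a < n * m" "k * m + b < (n + 1) * m"
    using assms block_index_less by blast+
  then show ?thesis
    using assms unfolding M_mat_def of_blocks_def by simp
qed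

text \<open>Block column \<open>k\<close> of M holds the identity in block row \<open>k\<close> and
  \<open>W\<close> in block row \<open>k - 1\<close>. Column \<open>n\<close> has no identity and
  column \<open>0\<close> no \<open>W\<close>; zero vectors pad these two ends, so one formula
  serves every \<open>k\<close>.\<close>

lemma vec_block_adjoint_M_mat:
  assumes W: "W \<in> carrier_mat m m" and x: "x \<in> carrier_vec (n * m)" and k: "k < n + 1"
  shows "vec_block m (mat_adjoint (M_mat n m W) *\<^sub>v x) k =
    (if k < n then vec_block m x k else 0\<^sub>v m) +
    mat_adjoint W *\<^sub>v (case k of 0 \<Rightarrow> 0\<^sub>v m | Suc j \<Rightarrow> vec_block m x j)" (is "?l = ?y + _ *\<^sub>v ?z")
proof (rule eq_vecI)
  note M = M_mat_carrier[of n m W]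
  have z: "?z \<in> carrier_vec m" by (cases k) auto
  show "dim_vec ?l = dim_vec (?y + mat_adjoint W *\<^sub>v ?z)"
    using W by (simp add: vec_block_def)
  fix b assume "b < dim_vec (?y + mat_adjoint W *\<^sub>v ?z)"
  then have b: "b < m" using W by simp
  have kb: "k * m + b < (n + 1) * m" using k b by (rule block_index_less)
  have "?l $ b = (mat_adjoint (M_mat n m W) *\<^sub>v x) $ (k * m + b)"
    using b by (simp add: vec_block_def)
  also have "\<dots> = (\<Sum>i<n * m. cnj (M_mat n m W $$ (i, k * m + b)) * x $ i)"
    unfolding mult_mat_vec_index_sum[OF mat_adjoint_carrier[OF M] x kb]
    by (intro sum.cong) (auto simp: mat_adjoint_index[OF M kb])
  also have "\<dots> = (\<Sum>j<n. \<Sum>a<m. cnj (if k = j then 1\<^sub>m m $$ (a, b)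
      else if k = j + 1 then W $$ (a, b) else 0) * x $ (j * m + a))"
    unfolding sum_blocks using k b by (intro sum.cong refl) (simp add: M_mat_index)
  \<comment> \<open>At most two block rows contribute: \<open>j = k\<close>, absent for
    \<open>k = n\<close>, and \<open>j + 1 = k\<close>, absent for \<open>k = 0\<close>.\<close>
  also have "\<dots> = (\<Sum>j<n. (if j = k then vec_block m x k $ b else 0) +
      (if k = j + 1 then \<Sum>a<m. cnj (W $$ (a, b)) * vec_block m x j $ a else 0))"
  proof (intro sum.cong refl)
    fix j
    have "(\<Sum>a<m. cnj (1\<^sub>m m $$ (a, b)) * x $ (j * m + a)) =
        (\<Sum>a<m. if a = b then x $ (j * m + a) else 0)"
      using b by (intro sum.cong) auto
    also have "\<dots> = vec_block m x j $ b" using b by (simp add: vec_block_def)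
    finally have "(\<Sum>a<m. cnj (1\<^sub>m m $$ (a, b)) * x $ (j * m + a)) = vec_block m x j $ b" .
    then show "(\<Sum>a<m. cnj (if k = j then 1\<^sub>m m $$ (a, b)
          else if k = j + 1 then W $$ (a, b) else 0) * x $ (j * m + a)) =
        (if j = k then vec_block m x k $ b else 0) +
        (if k = j + 1 then \<Sum>a<m. cnj (W $$ (a, b)) * vec_block m x j $ a else 0)"
      by (cases "k = j"; cases "k = j + 1") (auto simp: vec_block_def)
  qed
  also have "\<dots> = ?y $ b + (\<Sum>a<m. cnj (W $$ (a, b)) * ?z $ a)"
    using k b by (cases k) (auto simp: sum.distrib)
  also have "(\<Sum>a<m. cnj (W $$ (a, b)) * ?z $ a) = (mat_adjoint W *\<^sub>v ?z) $ b"
    unfolding mult_mat_vec_index_sum[OF mat_adjoint_carrier[OF W] z b]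
    by (intro sum.cong) (auto simp: mat_adjoint_index[OF W b])
  finally show "?l $ b = (?y + mat_adjoint W *\<^sub>v ?z) $ b"
    using W b by simp
qed

section \<open>Bounds for the form of M and for its condition number\<close>

lemma M_mat_form_bounds:
  assumes W: "W \<in> carrier_mat m m" and m: "0 < m" and x: "x \<in> carrier_vec (n * m)"
  defines "N \<equiv> sq_norm (mat_adjoint (M_mat n m W) *\<^sub>v x)"
  shows "N \<le> (1 + 2 * sigma_max W + (sigma_max W)\<^sup>2) * sq_norm x"
    and "(1 - 2 * sigma_max W + (sigma_min W)\<^sup>2) * sq_norm x \<le> N"
proof -
  define y where "y k = (if k < n then vec_block m x k else 0\<^sub>v m)" for k
  define z where "z k = (case k of 0 \<Rightarrow> 0\<^sub>v m | Suc j \<Rightarrow> vec_block m x j)" for k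
  let ?w = "\<lambda>k. mat_adjoint W *\<^sub>v z k"
  have y: "y k \<in> carrier_vec m" for k unfolding y_def by simp
  have z: "z k \<in> carrier_vec m" for k unfolding z_def by (cases k) auto
  have w: "?w k \<in> carrier_vec m" for k
    using mat_adjoint_carrier[OF W] z by simp
  \<comment> \<open>Both families run once through the blocks of \<open>x\<close> and contain one
    zero block, at \<open>k = n\<close> for \<open>y\<close> and at \<open>k = 0\<close> for
    \<open>z\<close>. Hence the cross terms total at most \<open>2 * sigma_max W * sq_norm x\<close>
    in absolute value.\<close>
  have sum_y: "(\<Sum>k<n + 1. sq_norm (y k)) = sq_norm x"
    unfolding sq_norm_vec_blocks[OF x] by (simp add: y_def)
  have sum_z: "(\<Sum>k<n + 1. sq_norm (z k)) = sq_norm x"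
    unfolding sq_norm_vec_blocks[OF x] by (simp add: z_def sum.lessThan_Suc_shift del: sum.lessThan_Suc)
  have "mat_adjoint (M_mat n m W) *\<^sub>v x \<in> carrier_vec ((n + 1) * m)"
    using mat_adjoint_carrier[OF M_mat_carrier] x by (rule mult_mat_vec_carrier)
  then have "N = (\<Sum>k<n + 1. sq_norm (y k + ?w k))"
    unfolding N_def using vec_block_adjoint_M_mat[OF W x]
    by (simp only: sq_norm_vec_blocks y_def z_def) (simp del: sum.lessThan_Suc)
  also have "\<dots> = (\<Sum>k<n + 1. sq_norm (y k) + sq_norm (?w k) + 2 * Re (y k \<bullet>c ?w k))"
    by (simp only: sq_norm_add[OF y w])
  finally have N: "N = \<dots>" .
  have cross_abs: "\<bar>2 * Re (y k \<bullet>c ?w k)\<bar> \<le> sigma_max W * (sq_norm (y k) + sq_norm (z k))" for k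
    using abs_Re_cscalar_prod_sigma_max_le[OF W m y z] by (simp add: abs_mult)
  have cross: "2 * Re (y k \<bullet>c ?w k) \<le> sigma_max W * (sq_norm (y k) + sq_norm (z k))"
    "- sigma_max W * (sq_norm (y k) + sq_norm (z k)) \<le> 2 * Re (y k \<bullet>c ?w k)" for k
    using cross_abs[of k] by (simp_all add: abs_le_iff)
  have "N \<le> (\<Sum>k<n + 1. sq_norm (y k) + (sigma_max W)\<^sup>2 * sq_norm (z k) +
      sigma_max W * (sq_norm (y k) + sq_norm (z k)))"
    unfolding N using cross sigma_max_bound(2)[OF W m z]
    by (intro sum_mono add_mono order_refl) simp_all
  also have "\<dots> = (1 + 2 * sigma_max W + (sigma_max W)\<^sup>2) * sq_norm x"
    unfolding sum.distrib sum_distrib_left[symmetric] sum_y sum_z by (simp add: algebra_simps)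
  finally show "N \<le> (1 + 2 * sigma_max W + (sigma_max W)\<^sup>2) * sq_norm x" .
  have "(1 - 2 * sigma_max W + (sigma_min W)\<^sup>2) * sq_norm x =
      (\<Sum>k<n + 1. sq_norm (y k) + (sigma_min W)\<^sup>2 * sq_norm (z k) +
        (- sigma_max W) * (sq_norm (y k) + sq_norm (z k)))"
    unfolding sum.distrib sum_distrib_left[symmetric] sum_y sum_z by (simp add: algebra_simps)
  also have "\<dots> \<le> N"
    unfolding N using cross sigma_min_bound(2)[OF W m z]
    by (intro sum_mono add_mono order_refl) simp_all
  finally show "(1 - 2 * sigma_max W + (sigma_min W)\<^sup>2) * sq_norm x \<le> N" .
qed

theorem proposition3p23:
  fixes n m :: nat and W :: "complex mat"
  assumes "n \<ge> 1" and "m \<ge> 1"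
    and "W \<in> carrier_mat m m"
    and "row_block_strictly_diag_dominant n m (A_mat n m W)"
    and "sigma_max W < 1 / 2"
  shows "cond_number (M_mat n m W) \<le>
    sqrt ((1 + 2 * sigma_max W + (sigma_max W)\<^sup>2) /
          (1 - 2 * sigma_max W + (sigma_min W)\<^sup>2))"
proof -
  let ?M = "M_mat n m W"
  let ?U = "1 + 2 * sigma_max W + (sigma_max W)\<^sup>2"
  let ?L = "1 - 2 * sigma_max W + (sigma_min W)\<^sup>2"
  have m: "0 < m" and nm: "0 < n * m" using assms by auto
  note W = assms(3) and M = M_mat_carrier[of n m W]
  \<comment> \<open>\<open>1 - 2 * sigma_max W\<close> is already positive, and the square only adds
    to it.\<close>
  have L: "0 < ?L"
    using assms(5) zero_le_power2[of "sigma_min W"] by linarith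
  \<comment> \<open>Evaluate the upper form bound where \<open>sigma_max ?M\<close> is attained and
    cancel the positive \<open>sq_norm x\<close>; the lower bound is treated likewise.\<close>
  have max: "(sigma_max ?M)\<^sup>2 \<le> ?U"
  proof -
    obtain x where x: "x \<in> carrier_vec (n * m)" "x \<noteq> 0\<^sub>v (n * m)"
      "sq_norm (mat_adjoint ?M *\<^sub>v x) = (sigma_max ?M)\<^sup>2 * sq_norm x"
      using singular_value_attained[OF M sigma_max_bound(1)[OF M nm]] by blast
    show ?thesis
      using M_mat_form_bounds(1)[OF W m x(1)] sq_norm_pos[OF x(1,2)] unfolding x(3) by simp
  qed
  have min: "?L \<le> (sigma_min ?M)\<^sup>2"
  proof -
    obtain x where x: "x \<in> carrier_vec (n * m)" "x \<noteq> 0\<^sub>v (n * m)"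
      "sq_norm (mat_adjoint ?M *\<^sub>v x) = (sigma_min ?M)\<^sup>2 * sq_norm x"
      using singular_value_attained[OF M sigma_min_bound(1)[OF M nm]] by blast
    show ?thesis
      using M_mat_form_bounds(2)[OF W m x(1)] sq_norm_pos[OF x(1,2)] unfolding x(3) by simp
  qed
  \<comment> \<open>Numerator and denominator are compared as squares, with \<open>?L\<close>
    positive; \<open>real_le_rsqrt\<close> then takes the root.\<close>
  have "(cond_number ?M)\<^sup>2 \<le> ?U / ?L"
    unfolding cond_number_def power_divide
    using max min L zero_le_power2[of "sigma_max ?M"] by (intro frac_le) linarith+
  then show ?thesis by (rule real_le_rsqrt)
qed

end
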